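(* Let $G$ be a three-dimensional Lie group with a bi-invariant metric, $\alpha$ a curve in $G$ with Frenet apparatus $\{T,N,B,\kappa,\tau\}$, and let $\varphi(s,v)=\alpha(s)+vT(s)$ be the tangent developable surface in $G$. The distribution parameter, Gaussian curvature and mean curvature of $\varphi$ are $$\lambda=0,\qquad K=0,\qquad H=-\frac{\tau+\tau_G}{2v^2\kappa},$$ and the geodesic curvature, normal curvature and geodesic torsion of $\alpha$ with respect to $\varphi$ are $$\kappa_{g_\varphi}=-\kappa,\qquad \kappa_{n_\varphi}=0,\qquad \tau_{g_\varphi}=0.$$
   Context: $G$ carries a bi-invariant Riemannian metric $\langle\cdot,\cdot\rangle$ with Levi-Civita connection $D$ and Lie algebra $\mathfrak g$ with bracket $[\cdot,\cdot]$; vector fields along a curve are written in an orthonormal basis of left-invariant fields. The curve $\alpha$ is parametrized by arc length $s$, $T=\alpha'$, $\kappa\ne0$, $\tau_G=\tfrac12\langle[T,N],B\rangle$, with Frenet formulas $D_TT=\kappa N$, $D_TN=-\kappa T+(\tau+\tau_G)B$, $D_TB=-(\tau+\tau_G)N$. The cross product $\times$ and $\det$ are those of the oriented Euclidean space $\mathfrak g$ with $T\times N=B$. For a surface $\varphi(s,v)=\alpha(s)+vX(s)$ (formal expression, $X$ a unit vector field along $\alpha$; here $X=T$), derivatives are computed as $\varphi_s=T+vD_TX$, $\varphi_v=X$, $\varphi_{ss}=D_T\varphi_s$, $\varphi_{sv}=D_TX$, $\varphi_{vv}=0$. Unit normal: $U=\frac{\varphi_s\times\varphi_v}{\|\varphi_s\times\varphi_v\|}$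 (here the paper has $U=-B$). Distribution parameter: $\lambda=\frac{\det(T,X,D_TX)}{\|D_TX\|^2}$. With $E=\langle\varphi_s,\varphi_s\rangle$, $F=\langle\varphi_s,\varphi_v\rangle$, $\mathsf G=\langle\varphi_v,\varphi_v\rangle$, $e=\langle\varphi_{ss},U\rangle$, $f=\langle\varphi_{sv},U\rangle$, $g=\langle\varphi_{vv},U\rangle$: $K=\frac{eg-f^2}{E\mathsf G-F^2}$, $H=\frac{Eg+\mathsf Ge-2Ff}{2(E\mathsf G-F^2)}$. Further $\kappa_{g_\varphi}=\langle U\times T,D_TT\rangle$, $\kappa_{n_\varphi}=\langle D_TT,U\rangle$, $\tau_{g_\varphi}=\langle U\times D_TU,D_TT\rangle$. Denominators are understood to be nonzero.
   Formalization: The printed H contradicts the definitions (e.g. a helix in R^3, v=2); H=-(τ+τ_G)/(2vκ) is proved instead. U=-B, this H and κ_g=-κ hold for vκ>0; for vκ<0 the normalized normal is U=B, and H and κ_g are proved with the opposite sign. *)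

theory Defs
  imports "HOL-Analysis.Analysis" "HOL-Analysis.Cross3"
begin

fun C_k_on :: "nat \<Rightarrow> 'a::real_normed_vector set \<Rightarrow> ('a \<Rightarrow> 'b::real_normed_vector) \<Rightarrow> bool" where
  "C_k_on 0 S f \<longleftrightarrow> continuous_on S f"
| "C_k_on (Suc k) S f \<longleftrightarrow>
     (\<forall>x\<in>S. f differentiable (at x)) \<and>
     (\<forall>v. C_k_on k S (\<lambda>x. frechet_derivative f (at x) v))"

definition smooth_on :: "'a::real_normed_vector set \<Rightarrow> ('a \<Rightarrow> 'b::real_normed_vector) \<Rightarrow> bool" where
  "smooth_on S f \<longleftrightarrow> (\<forall>k. C_k_on k S f)"

type_synonym ('m, 'e) chart = "'m set \<times> ('m \<Rightarrow> 'e)"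

definition smooth_atlas :: "('m::topological_space, 'e::euclidean_space) chart set \<Rightarrow> bool" where
  "smooth_atlas A \<longleftrightarrow>
     (\<Union>(U, x)\<in>A. U) = UNIV \<and>
     (\<forall>(U, x)\<in>A. open U \<and> open (x ` U) \<and> homeomorphism U (x ` U) x (inv_into U x)) \<and>
     (\<forall>(U, x)\<in>A. \<forall>(V, y)\<in>A. smooth_on (x ` (U \<inter> V)) (y \<circ> inv_into U x))"

text \<open>The domain of the map is the union of the chart domains of \<open>A\<close>, so that
  \<open>{(I, id)}\<close> describes an open subset \<open>I\<close> of a Euclidean space.\<close>

definition smooth_map ::
  "('m::topological_space, 'e::euclidean_space) chart set \<Rightarrow>
   ('n::topological_space, 'f::euclidean_space) chart set \<Rightarrow> ('m \<Rightarrow> 'n) \<Rightarrow> bool" where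
  "smooth_map A A' f \<longleftrightarrow>
     continuous_on (\<Union>(U, x)\<in>A. U) f \<and>
     (\<forall>(U, x)\<in>A. \<forall>(V, y)\<in>A'. smooth_on (x ` (U \<inter> f -` V)) (y \<circ> f \<circ> inv_into U x))"

definition product_atlas ::
  "('m, 'e) chart set \<Rightarrow> ('n, 'f) chart set \<Rightarrow> ('m \<times> 'n, 'e \<times> 'f) chart set" where
  "product_atlas A A' = {(U \<times> V, map_prod x y) | U x V y. (U, x) \<in> A \<and> (V, y) \<in> A'}"

definition lie_group ::
  "('g::{t2_space,second_countable_topology}, 'e::euclidean_space) chart set \<Rightarrow>
   ('g \<Rightarrow> 'g \<Rightarrow> 'g) \<Rightarrow> 'g \<Rightarrow> ('g \<Rightarrow> 'g) \<Rightarrow> bool" where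
  "lie_group A mul e invg \<longleftrightarrow>
     smooth_atlas A \<and> Groups.group mul e invg \<and>
     smooth_map (product_atlas A A) A (\<lambda>(a, b). mul a b) \<and> smooth_map A A invg"

definition smooth_functions ::
  "('m::topological_space, 'e::euclidean_space) chart set \<Rightarrow> ('m \<Rightarrow> real) set" where
  "smooth_functions A = {f. smooth_map A {(UNIV, id)} f}"

text \<open>A vector field is a derivation of the algebra of smooth functions. On functions that are
  not smooth it is set to \<open>0\<close>, so that equality of vector fields is equality in HOL and
  sums and multiples of vector fields can be formed pointwise.\<close>

type_synonym 'm vfield = "('m \<Rightarrow> real) \<Rightarrow> 'm \<Rightarrow> real"

definition vector_fields ::
  "('m::topological_space, 'e::euclidean_space) chart set \<Rightarrow> 'm vfield set" where
  "vector_fields A = {X.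
     (\<forall>f. f \<notin> smooth_functions A \<longrightarrow> X f = (\<lambda>_. 0)) \<and>
     (\<forall>f\<in>smooth_functions A. X f \<in> smooth_functions A) \<and>
     (\<forall>f\<in>smooth_functions A. \<forall>h\<in>smooth_functions A.
        X (\<lambda>p. f p + h p) = (\<lambda>p. X f p + X h p)) \<and>
     (\<forall>c. \<forall>f\<in>smooth_functions A. X (\<lambda>p. c * f p) = (\<lambda>p. c * X f p)) \<and>
     (\<forall>f\<in>smooth_functions A. \<forall>h\<in>smooth_functions A.
        X (\<lambda>p. f p * h p) = (\<lambda>p. X f p * h p + f p * X h p))}"

definition vf_add :: "'m vfield \<Rightarrow> 'm vfield \<Rightarrow> 'm vfield" where
  "vf_add X Y = (\<lambda>f p. X f p + Y f p)"

definition vf_scale :: "('m \<Rightarrow> real) \<Rightarrow> 'm vfield \<Rightarrow> 'm vfield" where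
  "vf_scale h X = (\<lambda>f p. h p * X f p)"

definition vf_bracket :: "'m vfield \<Rightarrow> 'm vfield \<Rightarrow> 'm vfield" where
  "vf_bracket X Y = (\<lambda>f p. X (Y f) p - Y (X f) p)"

definition push_forward :: "('m \<Rightarrow> 'm) \<Rightarrow> 'm vfield \<Rightarrow> 'm vfield" where
  "push_forward \<phi> X = (\<lambda>f p. X (f \<circ> \<phi>) (inv \<phi> p))"

text \<open>A Riemannian metric and an affine connection are given through their action on global
  vector fields. By \<open>C\<^sup>\<infinity>\<close>-bilinearity, \<open>m X Y p\<close> depends only on the values
  of \<open>X\<close> and \<open>Y\<close> at \<open>p\<close>.\<close>

definition riemannian_metric ::
  "('m::topological_space, 'e::euclidean_space) chart set \<Rightarrow>
   ('m vfield \<Rightarrow> 'm vfield \<Rightarrow> 'm \<Rightarrow> real) \<Rightarrow> bool" where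
  "riemannian_metric A m \<longleftrightarrow>
     (\<forall>X\<in>vector_fields A. \<forall>Y\<in>vector_fields A.
        m X Y \<in> smooth_functions A \<and> m X Y = m Y X) \<and>
     (\<forall>X\<in>vector_fields A. \<forall>Y\<in>vector_fields A. \<forall>Z\<in>vector_fields A.
        m (vf_add X Y) Z = (\<lambda>p. m X Z p + m Y Z p)) \<and>
     (\<forall>h\<in>smooth_functions A. \<forall>X\<in>vector_fields A. \<forall>Z\<in>vector_fields A.
        m (vf_scale h X) Z = (\<lambda>p. h p * m X Z p)) \<and>
     (\<forall>X\<in>vector_fields A. \<forall>p.
        m X X p \<ge> 0 \<and> (m X X p = 0 \<longleftrightarrow> (\<forall>f\<in>smooth_functions A. X f p = 0)))"

definition bi_invariant_metric ::
  "('m::topological_space, 'e::euclidean_space) chart set \<Rightarrow> ('m \<Rightarrow> 'm \<Rightarrow> 'm) \<Rightarrow>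
   ('m vfield \<Rightarrow> 'm vfield \<Rightarrow> 'm \<Rightarrow> real) \<Rightarrow> bool" where
  "bi_invariant_metric A mul m \<longleftrightarrow>
     riemannian_metric A m \<and>
     (\<forall>X\<in>vector_fields A. \<forall>Y\<in>vector_fields A. \<forall>a p.
        m (push_forward (\<lambda>b. mul a b) X) (push_forward (\<lambda>b. mul a b) Y) (mul a p) = m X Y p \<and>
        m (push_forward (\<lambda>b. mul b a) X) (push_forward (\<lambda>b. mul b a) Y) (mul p a) = m X Y p)"

definition affine_connection ::
  "('m::topological_space, 'e::euclidean_space) chart set \<Rightarrow>
   ('m vfield \<Rightarrow> 'm vfield \<Rightarrow> 'm vfield) \<Rightarrow> bool" where
  "affine_connection A nabla \<longleftrightarrow>
     (\<forall>X\<in>vector_fields A. \<forall>Y\<in>vector_fields A. nabla X Y \<in> vector_fields A) \<and>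
     (\<forall>X\<in>vector_fields A. \<forall>Y\<in>vector_fields A. \<forall>Z\<in>vector_fields A.
        nabla (vf_add X Y) Z = vf_add (nabla X Z) (nabla Y Z) \<and>
        nabla Z (vf_add X Y) = vf_add (nabla Z X) (nabla Z Y)) \<and>
     (\<forall>h\<in>smooth_functions A. \<forall>X\<in>vector_fields A. \<forall>Y\<in>vector_fields A.
        nabla (vf_scale h X) Y = vf_scale h (nabla X Y) \<and>
        nabla X (vf_scale h Y) = vf_add (vf_scale (X h) Y) (vf_scale h (nabla X Y)))"

definition levi_civita ::
  "('m::topological_space, 'e::euclidean_space) chart set \<Rightarrow>
   ('m vfield \<Rightarrow> 'm vfield \<Rightarrow> 'm \<Rightarrow> real) \<Rightarrow>
   ('m vfield \<Rightarrow> 'm vfield \<Rightarrow> 'm vfield) \<Rightarrow> bool" where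
  "levi_civita A m nabla \<longleftrightarrow>
     affine_connection A nabla \<and>
     (\<forall>X\<in>vector_fields A. \<forall>Y\<in>vector_fields A. \<forall>p f.
        nabla X Y f p - nabla Y X f p = vf_bracket X Y f p) \<and>
     (\<forall>X\<in>vector_fields A. \<forall>Y\<in>vector_fields A. \<forall>Z\<in>vector_fields A. \<forall>p.
        X (m Y Z) p = m (nabla X Y) Z p + m Y (nabla X Z) p)"

definition left_invariant :: "('g \<Rightarrow> 'g \<Rightarrow> 'g) \<Rightarrow> 'g vfield \<Rightarrow> bool" where
  "left_invariant mul X \<longleftrightarrow> (\<forall>a. push_forward (\<lambda>b. mul a b) X = X)"

definition orthonormal_left_invariant_frame ::
  "('g::topological_space, real^3) chart set \<Rightarrow> ('g \<Rightarrow> 'g \<Rightarrow> 'g) \<Rightarrow>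
   ('g vfield \<Rightarrow> 'g vfield \<Rightarrow> 'g \<Rightarrow> real) \<Rightarrow> (3 \<Rightarrow> 'g vfield) \<Rightarrow> bool" where
  "orthonormal_left_invariant_frame A mul m E \<longleftrightarrow>
     (\<forall>i. E i \<in> vector_fields A \<and> left_invariant mul (E i)) \<and>
     (\<forall>i j p. m (E i) (E j) p = (if i = j then 1 else 0))"

text \<open>The frame identifies the Lie algebra of left-invariant fields isometrically with
  \<open>real^3\<close>; \<open>left_field E u\<close> is the element with components \<open>u\<close>. The orientation of the Lie
  algebra is the one for which the frame \<open>E\<close> is positive, so its cross product and
  determinant are those of \<open>real^3\<close>.\<close>

definition left_field :: "(3 \<Rightarrow> 'g vfield) \<Rightarrow> real^3 \<Rightarrow> 'g vfield" where
  "left_field E u = (\<lambda>f p. \<Sum>i\<in>UNIV. u $ i * E i f p)"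

definition lie_bracket ::
  "('g vfield \<Rightarrow> 'g vfield \<Rightarrow> 'g \<Rightarrow> real) \<Rightarrow> 'g \<Rightarrow> (3 \<Rightarrow> 'g vfield) \<Rightarrow>
   real^3 \<Rightarrow> real^3 \<Rightarrow> real^3" where
  "lie_bracket m e E u w = (\<chi> k. m (vf_bracket (left_field E u) (left_field E w)) (E k) e)"

text \<open>\<open>T s\<close> consists of the components of the velocity of \<open>\<alpha>\<close> at \<open>s\<close>.\<close>

definition velocity_components ::
  "('g::topological_space, real^3) chart set \<Rightarrow> (3 \<Rightarrow> 'g vfield) \<Rightarrow> real set \<Rightarrow>
   (real \<Rightarrow> 'g) \<Rightarrow> (real \<Rightarrow> real^3) \<Rightarrow> bool" where
  "velocity_components A E I \<alpha> T \<longleftrightarrow>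
     (\<forall>s\<in>I. \<forall>f\<in>smooth_functions A.
        ((\<lambda>t. f (\<alpha> t)) has_real_derivative left_field E (T s) f (\<alpha> s)) (at s))"

text \<open>The covariant derivative of \<open>\<Sum>\<^sub>j W\<^sub>j E\<^sub>j\<close> along \<open>\<alpha>\<close> is
  \<open>\<Sum>\<^sub>j W\<^sub>j' E\<^sub>j + \<Sum>\<^sub>j W\<^sub>j \<nabla>\<^sub>T E\<^sub>j\<close>.\<close>

definition cov_deriv ::
  "('g vfield \<Rightarrow> 'g vfield \<Rightarrow> 'g \<Rightarrow> real) \<Rightarrow> ('g vfield \<Rightarrow> 'g vfield \<Rightarrow> 'g vfield) \<Rightarrow>
   (3 \<Rightarrow> 'g vfield) \<Rightarrow> (real \<Rightarrow> 'g) \<Rightarrow> (real \<Rightarrow> real^3) \<Rightarrow>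
   (real \<Rightarrow> real^3) \<Rightarrow> real \<Rightarrow> real^3" where
  "cov_deriv m nabla E \<alpha> T W s =
     vector_derivative W (at s) +
     (\<chi> k. m (nabla (left_field E (T s)) (left_field E (W s))) (E k) (\<alpha> s))"

definition group_torsion ::
  "(real^3 \<Rightarrow> real^3 \<Rightarrow> real^3) \<Rightarrow> (real \<Rightarrow> real^3) \<Rightarrow> (real \<Rightarrow> real^3) \<Rightarrow>
   (real \<Rightarrow> real^3) \<Rightarrow> real \<Rightarrow> real" where
  "group_torsion br T N B s = 1/2 * (br (T s) (N s) \<bullet> B s)"

definition frenet_apparatus ::
  "((real \<Rightarrow> real^3) \<Rightarrow> real \<Rightarrow> real^3) \<Rightarrow> (real^3 \<Rightarrow> real^3 \<Rightarrow> real^3) \<Rightarrow> real set \<Rightarrow>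
   (real \<Rightarrow> real^3) \<Rightarrow> (real \<Rightarrow> real^3) \<Rightarrow> (real \<Rightarrow> real^3) \<Rightarrow>
   (real \<Rightarrow> real) \<Rightarrow> (real \<Rightarrow> real) \<Rightarrow> bool" where
  "frenet_apparatus D br I T N B \<kappa> \<tau> \<longleftrightarrow>
     smooth_on I T \<and> smooth_on I N \<and> smooth_on I B \<and> smooth_on I \<kappa> \<and> smooth_on I \<tau> \<and>
     (\<forall>s\<in>I.
        norm (T s) = 1 \<and> norm (N s) = 1 \<and> T s \<bullet> N s = 0 \<and> cross3 (T s) (N s) = B s \<and>
        \<kappa> s \<noteq> 0 \<and>
        D T s = \<kappa> s *\<^sub>R N s \<and>
        D N s = - \<kappa> s *\<^sub>R T s + (\<tau> s + group_torsion br T N B s) *\<^sub>R B s \<and>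
        D B s = - (\<tau> s + group_torsion br T N B s) *\<^sub>R N s)"

text \<open>Below, \<open>X\<close> is the field of rulings and \<open>D\<close> is covariant differentiation along
  \<open>\<alpha>\<close>. The surface is the formal expression \<open>\<alpha>(s) + v X(s)\<close>: only its derivatives,
  which are fields along \<open>\<alpha>\<close> for each \<open>v\<close>, have a meaning.\<close>

type_synonym field_along = "real \<Rightarrow> real^3"

definition phi_s :: "(field_along \<Rightarrow> field_along) \<Rightarrow> field_along \<Rightarrow> field_along \<Rightarrow> real \<Rightarrow> field_along"
  where "phi_s D T X v = (\<lambda>s. T s + v *\<^sub>R D X s)"

definition phi_v :: "field_along \<Rightarrow> real \<Rightarrow> field_along"
  where "phi_v X v = X"

definition phi_ss :: "(field_along \<Rightarrow> field_along) \<Rightarrow> field_along \<Rightarrow> field_along \<Rightarrow> real \<Rightarrow> field_along"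
  where "phi_ss D T X v = D (phi_s D T X v)"

definition phi_sv :: "(field_along \<Rightarrow> field_along) \<Rightarrow> field_along \<Rightarrow> real \<Rightarrow> field_along"
  where "phi_sv D X v = D X"

definition phi_vv :: "real \<Rightarrow> field_along"
  where "phi_vv v = (\<lambda>s. 0)"

definition unit_normal ::
  "(field_along \<Rightarrow> field_along) \<Rightarrow> field_along \<Rightarrow> field_along \<Rightarrow> real \<Rightarrow> field_along" where
  "unit_normal D T X v = (\<lambda>s.
     cross3 (phi_s D T X v s) (phi_v X v s) /\<^sub>R norm (cross3 (phi_s D T X v s) (phi_v X v s)))"

definition distribution_parameter ::
  "(field_along \<Rightarrow> field_along) \<Rightarrow> field_along \<Rightarrow> field_along \<Rightarrow> real \<Rightarrow> real" where
  "distribution_parameter D T X s =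
     det (vector [T s, X s, D X s] :: real^3^3) / (norm (D X s))\<^sup>2"

definition gauss_curvature ::
  "(field_along \<Rightarrow> field_along) \<Rightarrow> field_along \<Rightarrow> field_along \<Rightarrow> real \<Rightarrow> real \<Rightarrow> real" where
  "gauss_curvature D T X s v =
     (let U = unit_normal D T X v s;
          E = phi_s D T X v s \<bullet> phi_s D T X v s;
          F = phi_s D T X v s \<bullet> phi_v X v s;
          G = phi_v X v s \<bullet> phi_v X v s;
          e = phi_ss D T X v s \<bullet> U;
          f = phi_sv D X v s \<bullet> U;
          g = phi_vv v s \<bullet> U
      in (e * g - f\<^sup>2) / (E * G - F\<^sup>2))"

definition mean_curvature ::
  "(field_along \<Rightarrow> field_along) \<Rightarrow> field_along \<Rightarrow> field_along \<Rightarrow> real \<Rightarrow> real \<Rightarrow> real" where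
  "mean_curvature D T X s v =
     (let U = unit_normal D T X v s;
          E = phi_s D T X v s \<bullet> phi_s D T X v s;
          F = phi_s D T X v s \<bullet> phi_v X v s;
          G = phi_v X v s \<bullet> phi_v X v s;
          e = phi_ss D T X v s \<bullet> U;
          f = phi_sv D X v s \<bullet> U;
          g = phi_vv v s \<bullet> U
      in (E * g + G * e - 2 * F * f) / (2 * (E * G - F\<^sup>2)))"

text \<open>The curvatures of \<open>\<alpha>\<close> with respect to the surface are taken with the unit normal along
  the parameter curve of the given \<open>v\<close>; \<open>D (unit_normal D T X v)\<close> is its covariant
  derivative with respect to \<open>s\<close>.\<close>

definition geodesic_curvature ::
  "(field_along \<Rightarrow> field_along) \<Rightarrow> field_along \<Rightarrow> field_along \<Rightarrow> real \<Rightarrow> real \<Rightarrow> real" where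
  "geodesic_curvature D T X s v = cross3 (unit_normal D T X v s) (T s) \<bullet> D T s"

definition normal_curvature ::
  "(field_along \<Rightarrow> field_along) \<Rightarrow> field_along \<Rightarrow> field_along \<Rightarrow> real \<Rightarrow> real \<Rightarrow> real" where
  "normal_curvature D T X s v = D T s \<bullet> unit_normal D T X v s"

definition geodesic_torsion ::
  "(field_along \<Rightarrow> field_along) \<Rightarrow> field_along \<Rightarrow> field_along \<Rightarrow> real \<Rightarrow> real \<Rightarrow> real" where
  "geodesic_torsion D T X s v =
     cross3 (unit_normal D T X v s) (D (unit_normal D T X v) s) \<bullet> D T s"

end

theory Submission
  imports Defs
begin

text \<open>For fixed \<open>u\<close> the map sending \<open>w\<close> to the frame components of \<open>\<nabla>\<^sub>u w\<close> is linear, so \<open>D\<close> obeys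
  the Leibniz rule along the curve. With \<open>\<phi>\<^sub>s = T + v \<kappa> N\<close> and \<open>\<phi>\<^sub>v = T\<close> the unit normal is
  \<open>- sgn (v \<kappa>) B\<close>. The sign is locally constant in \<open>s\<close>, so the normal may be differentiated with
  the last Frenet formula, and everything else is algebra in the orthonormal frame \<open>T, N, B\<close>.\<close>

subsection \<open>Smooth functions and vector fields\<close>

text \<open>A Frechet derivative at a point of the open set \<open>S\<close> sees only the values on
  \<open>S\<close>, so agreement on \<open>S\<close> passes to all directional derivatives and the
  induction goes through. \<open>f\<close> and \<open>g\<close> stay arbitrary because the
  hypothesis is applied to these derivatives.\<close>

lemma C_k_on_cong:
  assumes "open S" "\<And>x. x \<in> S \<Longrightarrow> f x = g x" "C_k_on k S f"
  shows "C_k_on k S g"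
  using assms(2,3)
proof (induction k arbitrary: f g)
  case 0
  have "continuous_on S g"
    by (rule continuous_on_eq[of S f]) (use 0 in simp_all)
  then show ?case
    by simp
next
  case (Suc k)
  have df: "f differentiable at x" if "x \<in> S" for x
    using Suc.prems(2) that by simp
  have dg: "g differentiable at x" if "x \<in> S" for x
  proof -
    obtain f' where "(f has_derivative f') (at x)"
      using df[OF \<open>x \<in> S\<close>] unfolding differentiable_def by blast
    then have "(g has_derivative f') (at x)"
      by (rule has_derivative_transform_within_open[OF _ assms(1) \<open>x \<in> S\<close> Suc.prems(1)])
    then show ?thesis
      by (rule differentiableI)
  qed
  have eq: "frechet_derivative f (at x) = frechet_derivative g (at x)" if "x \<in> S" for x
    by (rule frechet_derivative_transform_within_open[OF df[OF that] assms(1) that Suc.prems(1)])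
  have "C_k_on k S (\<lambda>x. frechet_derivative g (at x) w)" for w
  proof (rule Suc.IH)
    show "frechet_derivative f (at x) w = frechet_derivative g (at x) w" if "x \<in> S" for x
      by (simp only: eq[OF that])
    show "C_k_on k S (\<lambda>x. frechet_derivative f (at x) w)"
      using Suc.prems(2) by simp
  qed
  then show ?case
    unfolding C_k_on.simps by (blast intro: dg)
qed

lemma C_k_on_const: "C_k_on k S (\<lambda>_. c)"
  by (induction k arbitrary: c) auto

text \<open>Differentiation commutes with constant coefficients, so each derivative is a combination
  of the same shape. This identity is known only on \<open>S\<close>, hence the appeal to
  \<open>C_k_on_cong\<close>.\<close>

lemma C_k_on_lincomb:
  assumes "open S" "C_k_on k S f" "C_k_on k S g"
  shows "C_k_on k S (\<lambda>x. a *\<^sub>R f x + b *\<^sub>R g x)"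
  using assms(2,3)
proof (induction k arbitrary: f g)
  case 0
  then show ?case
    by (auto intro!: continuous_intros)
next
  case (Suc k)
  let ?h = "\<lambda>x. a *\<^sub>R f x + b *\<^sub>R g x"
  have der: "(?h has_derivative (\<lambda>w. a *\<^sub>R frechet_derivative f (at x) w
      + b *\<^sub>R frechet_derivative g (at x) w)) (at x)" if "x \<in> S" for x
  proof -
    have "(f has_derivative frechet_derivative f (at x)) (at x)"
      "(g has_derivative frechet_derivative g (at x)) (at x)"
      using Suc.prems that by (auto simp flip: frechet_derivative_works)
    then show ?thesis
      by (auto intro!: derivative_eq_intros)
  qed
  have "C_k_on k S (\<lambda>x. frechet_derivative ?h (at x) w)" for w
  proof (rule C_k_on_cong[OF assms(1)])
    show "C_k_on k S (\<lambda>x. a *\<^sub>R frechet_derivative f (at x) w + b *\<^sub>R frechet_derivative g (at x) w)"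
      using Suc.prems by (intro Suc.IH) auto
  qed (simp flip: frechet_derivative_at[OF der])
  then show ?case
    using der by (auto simp: differentiable_def)
qed

lemma smooth_functions_iff:
  "f \<in> smooth_functions A \<longleftrightarrow> continuous_on (\<Union>(U, x)\<in>A. U) f \<and>
    (\<forall>(U, x)\<in>A. smooth_on (x ` U) (f \<circ> inv_into U x))"
  by (simp add: smooth_functions_def smooth_map_def)

lemma const_in_smooth_functions: "(\<lambda>_. c) \<in> smooth_functions A"
  by (simp add: smooth_functions_iff smooth_on_def o_def C_k_on_const)

lemma lincomb_in_smooth_functions:
  assumes A: "smooth_atlas A" and f: "f \<in> smooth_functions A" and h: "h \<in> smooth_functions A"
  shows "(\<lambda>p. a * f p + b * h p) \<in> smooth_functions A"
proof -
  have "smooth_on (x ` U) (\<lambda>q. a *\<^sub>R f (inv_into U x q) + b *\<^sub>R h (inv_into U x q))"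
    if "(U, x) \<in> A" for U x
  proof -
    have "open (x ` U)"
      using bspec[OF conjunct1[OF conjunct2[OF A[unfolded smooth_atlas_def]]] that] by simp
    moreover have "smooth_on (x ` U) (\<lambda>q. f (inv_into U x q))"
      "smooth_on (x ` U) (\<lambda>q. h (inv_into U x q))"
      using bspec[OF conjunct2[OF f[unfolded smooth_functions_iff]] that]
        bspec[OF conjunct2[OF h[unfolded smooth_functions_iff]] that]
      by (simp_all add: o_def)
    ultimately show ?thesis
      by (simp add: smooth_on_def C_k_on_lincomb del: real_scaleR_def)
  qed
  moreover have "continuous_on (\<Union>(U, x)\<in>A. U) (\<lambda>p. a * f p + b * h p)"
    using f h by (intro continuous_intros) (simp_all add: smooth_functions_iff)
  ultimately show ?thesis
    by (auto simp: smooth_functions_iff o_def)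
qed

lemma lincomb_in_vector_fields:
  assumes A: "smooth_atlas A" and X: "X \<in> vector_fields A" and Y: "Y \<in> vector_fields A"
  shows "(\<lambda>f p. a * X f p + b * Y f p) \<in> vector_fields A"
  using X Y unfolding vector_fields_def
  by (simp add: lincomb_in_smooth_functions[OF A] distrib_left distrib_right mult_ac add_ac)

lemma zero_in_vector_fields: "(\<lambda>f p. 0) \<in> vector_fields A"
  by (simp add: vector_fields_def const_in_smooth_functions)

text \<open>The product rule for 1 = 1 * 1 gives X 1 = 2 X 1, so X 1 = 0; homogeneity extends this
  to every constant.\<close>

lemma vector_field_const:
  assumes "X \<in> vector_fields A"
  shows "X (\<lambda>_. c) = (\<lambda>_. 0)"
proof -
  have one: "(\<lambda>_. 1) \<in> smooth_functions A"
    by (rule const_in_smooth_functions)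
  have mult: "\<forall>f\<in>smooth_functions A. \<forall>h\<in>smooth_functions A.
      X (\<lambda>p. f p * h p) = (\<lambda>p. X f p * h p + f p * X h p)"
    and scale: "\<forall>c. \<forall>f\<in>smooth_functions A. X (\<lambda>p. c * f p) = (\<lambda>p. c * X f p)"
    using assms by (simp_all add: vector_fields_def)
  have "X (\<lambda>p. 1 * 1) = (\<lambda>p. X (\<lambda>_. 1) p * 1 + 1 * X (\<lambda>_. 1) p)"
    by (rule mult[rule_format, OF one one])
  then have "X (\<lambda>_. 1) p = 0" for p
    by (auto dest: fun_cong[where x = p])
  moreover have "X (\<lambda>p. c * 1) = (\<lambda>p. c * X (\<lambda>_. 1) p)"
    by (rule scale[rule_format, OF one])
  ultimately show ?thesis
    by simp
qed

lemma left_field_in_vector_fields: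
  assumes A: "smooth_atlas A" and E: "\<forall>i. E i \<in> vector_fields A"
  shows "left_field E u \<in> vector_fields A"
proof -
  \<comment> \<open>The sum runs over an arbitrary finite \<open>J\<close> instead of all indices,
    so that induction on the index set is available.\<close>
  have "(\<lambda>f p. \<Sum>i\<in>J. u $ i * E i f p) \<in> vector_fields A" if "finite J" for J
    using that
  proof induction
    case empty
    then show ?case by (simp add: zero_in_vector_fields)
  next
    case (insert i J)
    then show ?case
      using lincomb_in_vector_fields[OF A E[rule_format] insert.IH, of "u $ i" i 1] insert.hyps
      by simp
  qed
  then show ?thesis
    by (simp add: left_field_def[abs_def])
qed

lemma left_field_add: "left_field E (u + w) = vf_add (left_field E u) (left_field E w)"
  by (simp add: left_field_def vf_add_def algebra_simps sum.distrib)

lemma left_field_scaleR: "left_field E (c *\<^sub>R u) = vf_scale (\<lambda>_. c) (left_field E u)"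
  by (simp add: left_field_def vf_scale_def algebra_simps sum_distrib_left)

subsection \<open>The covariant derivative along a curve\<close>

text \<open>A connection is only a derivation in its second argument, but left-invariant fields with
  fixed components have constant coefficients, whose derivatives vanish by
  \<open>vector_field_const\<close>. Hence \<open>cov_deriv\<close> is the ordinary derivative plus
  a linear map applied to the value of the field.\<close>

lemma linear_connection_components:
  assumes A: "smooth_atlas A" and m: "riemannian_metric A m" and nabla: "affine_connection A nabla"
    and E: "\<forall>i. E i \<in> vector_fields A"
  shows "linear (\<lambda>w. \<chi> k. m (nabla (left_field E u) (left_field E w)) (E k) p)"
proof
  note lf = left_field_in_vector_fields[OF A E]
  have nabla_vf: "nabla X Y \<in> vector_fields A"
    if "X \<in> vector_fields A" "Y \<in> vector_fields A" for X Y
    using nabla that by (simp add: affine_connection_def)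
  fix w w' :: "real^3" and c :: real
  have "nabla (left_field E u) (vf_add (left_field E w) (left_field E w')) =
      vf_add (nabla (left_field E u) (left_field E w)) (nabla (left_field E u) (left_field E w'))"
    using nabla by (simp add: affine_connection_def lf)
  moreover have "m (vf_add X Y) Z p = m X Z p + m Y Z p"
    if "X \<in> vector_fields A" "Y \<in> vector_fields A" "Z \<in> vector_fields A" for X Y Z
    using m that by (simp add: riemannian_metric_def)
  ultimately show "(\<chi> k. m (nabla (left_field E u) (left_field E (w + w'))) (E k) p) =
      (\<chi> k. m (nabla (left_field E u) (left_field E w)) (E k) p) +
      (\<chi> k. m (nabla (left_field E u) (left_field E w')) (E k) p)"
    by (simp add: vec_eq_iff left_field_add nabla_vf lf E)
  have "nabla (left_field E u) (vf_scale (\<lambda>_. c) (left_field E w)) =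
      vf_add (vf_scale (left_field E u (\<lambda>_. c)) (left_field E w))
        (vf_scale (\<lambda>_. c) (nabla (left_field E u) (left_field E w)))"
    using nabla by (simp add: affine_connection_def lf const_in_smooth_functions)
  also have "\<dots> = vf_scale (\<lambda>_. c) (nabla (left_field E u) (left_field E w))"
    by (simp add: vector_field_const[OF lf] vf_add_def vf_scale_def)
  finally have "nabla (left_field E u) (vf_scale (\<lambda>_. c) (left_field E w)) =
      vf_scale (\<lambda>_. c) (nabla (left_field E u) (left_field E w))" .
  moreover have "m (vf_scale (\<lambda>_. c) X) Z p = c * m X Z p"
    if "X \<in> vector_fields A" "Z \<in> vector_fields A" for X Z
    using m that by (simp add: riemannian_metric_def const_in_smooth_functions)
  ultimately show "(\<chi> k. m (nabla (left_field E u) (left_field E (c *\<^sub>R w))) (E k) p) =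
      c *\<^sub>R (\<chi> k. m (nabla (left_field E u) (left_field E w)) (E k) p)"
    by (simp add: vec_eq_iff left_field_scaleR nabla_vf lf E)
qed

text \<open>Needed because the formulas for the normal and for \<open>phi_s\<close> hold only near
  the given parameter. The filter is \<open>nhds s\<close>, which includes \<open>s\<close> itself,
  since the connection term uses the value \<open>W s\<close>.\<close>

lemma cov_deriv_cong:
  assumes "\<forall>\<^sub>F t in nhds s. W t = W' t"
  shows "cov_deriv m nabla E \<alpha> T W s = cov_deriv m nabla E \<alpha> T W' s"
proof -
  have "vector_derivative W (at s) = vector_derivative W' (at s)"
    by (rule vector_derivative_cong_eq) (use assms in auto)
  moreover have "W s = W' s"
    using assms by (rule eventually_nhds_x_imp_x)
  ultimately show ?thesis
    by (simp add: cov_deriv_def)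
qed

lemma cov_deriv_add:
  assumes "linear (\<lambda>w. \<chi> k. m (nabla (left_field E (T s)) (left_field E w)) (E k) (\<alpha> s))"
    and "W differentiable at s" "W' differentiable at s"
  shows "cov_deriv m nabla E \<alpha> T (\<lambda>t. W t + W' t) s =
    cov_deriv m nabla E \<alpha> T W s + cov_deriv m nabla E \<alpha> T W' s"
  using linear_add[OF assms(1)] assms(2,3) by (simp add: cov_deriv_def)

text \<open>The Leibniz rule along the curve: the ordinary product rule supplies the derivative of
  \<open>h\<close>, and linearity pulls \<open>h s\<close> out of the connection term.\<close>

lemma cov_deriv_scaleR:
  assumes "linear (\<lambda>w. \<chi> k. m (nabla (left_field E (T s)) (left_field E w)) (E k) (\<alpha> s))"
    and "h differentiable at s" "W differentiable at s"
  shows "cov_deriv m nabla E \<alpha> T (\<lambda>t. h t *\<^sub>R W t) s =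
    vector_derivative h (at s) *\<^sub>R W s + h s *\<^sub>R cov_deriv m nabla E \<alpha> T W s"
  using linear_scale[OF assms(1)] assms(2,3) by (simp add: cov_deriv_def algebra_simps)

lemma smooth_on_differentiable:
  assumes "smooth_on S f" "x \<in> S"
  shows "f differentiable at x"
  using assms unfolding smooth_on_def by (metis C_k_on.simps(2))

subsection \<open>Orthonormal frames in three-space\<close>

text \<open>The double products come from the Lagrange identity after swapping factors, and the norm
  from the inner product of two cross products.\<close>

lemma cross3_orthonormal:
  fixes t n :: "real^3"
  assumes "norm t = 1" "norm n = 1" "t \<bullet> n = 0"
  shows "cross3 n t = - cross3 t n" "cross3 (cross3 t n) t = n" "cross3 (cross3 t n) n = - t"
    and "norm (cross3 t n) = 1"
proof -
  have "t \<bullet> t = 1" "n \<bullet> n = 1" "n \<bullet> t = 0"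
    using assms by (simp_all add: norm_eq_1 inner_commute)
  then show "cross3 (cross3 t n) t = n" "cross3 (cross3 t n) n = - t" "norm (cross3 t n) = 1"
    using assms(3) by (simp_all add: cross_skew[of "cross3 t n"] Lagrange norm_eq_1 dot_cross)
  show "cross3 n t = - cross3 t n"
    by (rule cross_skew)
qed

text \<open>Here EG - F^2 is (v \<kappa>)^2, while the inner product of \<open>phi_ss\<close> with
  the normal is -|v \<kappa>| (\<tau> + \<open>\<tau>\<^sub>G\<close>); the quotient therefore has v
  \<kappa>, not v^2 \<kappa>, in its denominator. The normal is -B exactly when v \<kappa> > 0.
  Otherwise it is B, which reverses the signs of the mean and geodesic curvatures; hence the two
  cases.\<close>

theorem theorem4:
  fixes A :: "('g::{t2_space,second_countable_topology}, real^3) chart set"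
    and mul :: "'g \<Rightarrow> 'g \<Rightarrow> 'g" and e :: 'g and invg :: "'g \<Rightarrow> 'g"
    and m :: "'g vfield \<Rightarrow> 'g vfield \<Rightarrow> 'g \<Rightarrow> real"
    and nabla :: "'g vfield \<Rightarrow> 'g vfield \<Rightarrow> 'g vfield"
    and E :: "3 \<Rightarrow> 'g vfield"
    and I :: "real set" and \<alpha> :: "real \<Rightarrow> 'g"
    and T N B :: "real \<Rightarrow> real^3" and \<kappa> \<tau> :: "real \<Rightarrow> real"
    and D :: "(real \<Rightarrow> real^3) \<Rightarrow> real \<Rightarrow> real^3"
    and \<tau>\<^sub>G :: "real \<Rightarrow> real"
    and s v :: real
  assumes D_def: "D = cov_deriv m nabla E \<alpha> T"
    and tau_G_def: "\<tau>\<^sub>G = group_torsion (lie_bracket m e E) T N B"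
    and "lie_group A mul e invg"
    and "bi_invariant_metric A mul m"
    and "levi_civita A m nabla"
    and "orthonormal_left_invariant_frame A mul m E"
    and "open I" and "is_interval I"
    and "smooth_map {(I, id)} A \<alpha>"
    and "velocity_components A E I \<alpha> T"
    and "frenet_apparatus D (lie_bracket m e E) I T N B \<kappa> \<tau>"
    and "s \<in> I" and "v \<noteq> 0"
  shows "distribution_parameter D T T s = 0 \<and>
         gauss_curvature D T T s v = 0 \<and>
         (v * \<kappa> s > 0 \<longrightarrow>
            unit_normal D T T v s = - B s \<and>
            mean_curvature D T T s v = - (\<tau> s + \<tau>\<^sub>G s) / (2 * v * \<kappa> s) \<and>
            geodesic_curvature D T T s v = - \<kappa> s) \<and>
         (v * \<kappa> s < 0 \<longrightarrow>
            unit_normal D T T v s = B s \<and>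
            mean_curvature D T T s v = (\<tau> s + \<tau>\<^sub>G s) / (2 * v * \<kappa> s) \<and>
            geodesic_curvature D T T s v = \<kappa> s) \<and>
         normal_curvature D T T s v = 0 \<and>
         geodesic_torsion D T T s v = 0"
proof -
  have linear: "linear (\<lambda>w. \<chi> k. m (nabla (left_field E (T t)) (left_field E w)) (E k) (\<alpha> t))" for t
  proof (rule linear_connection_components[of A m nabla E "T t" "\<alpha> t"])
    show "smooth_atlas A" "riemannian_metric A m" "affine_connection A nabla"
      "\<forall>i. E i \<in> vector_fields A"
      using assms by (simp_all add: lie_group_def bi_invariant_metric_def levi_civita_def
          orthonormal_left_invariant_frame_def)
  qed
  note frenet = \<open>frenet_apparatus D (lie_bracket m e E) I T N B \<kappa> \<tau>\<close>
  have unit: "norm (T t) = 1" "norm (N t) = 1" "T t \<bullet> N t = 0" and B: "cross3 (T t) (N t) = B t"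
    and \<kappa>: "\<kappa> t \<noteq> 0" and DT: "D T t = \<kappa> t *\<^sub>R N t"
    and DN: "D N t = - \<kappa> t *\<^sub>R T t + (\<tau> t + \<tau>\<^sub>G t) *\<^sub>R B t"
    and DB: "D B t = - (\<tau> t + \<tau>\<^sub>G t) *\<^sub>R N t" if "t \<in> I" for t
    using frenet that by (simp_all add: frenet_apparatus_def tau_G_def)
  have diff: "T differentiable at t" "N differentiable at t" "B differentiable at t"
    "\<kappa> differentiable at t" if "t \<in> I" for t
    using frenet that by (auto simp: frenet_apparatus_def intro: smooth_on_differentiable)
  have cross: "cross3 (N t) (T t) = - B t" "cross3 (B t) (T t) = N t" "cross3 (B t) (N t) = - T t"
    "norm (B t) = 1" if "t \<in> I" for t
    using cross3_orthonormal[OF unit[OF that]] by (simp_all add: B[OF that])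
  let ?T = "T s" and ?N = "N s" and ?B = "B s" and ?\<mu> = "\<tau> s + \<tau>\<^sub>G s"
  have dot: "?T \<bullet> ?T = 1" "?N \<bullet> ?N = 1" "?B \<bullet> ?B = 1" "?T \<bullet> ?N = 0" "?N \<bullet> ?T = 0"
    "?T \<bullet> ?B = 0" "?B \<bullet> ?T = 0" "?N \<bullet> ?B = 0" "?B \<bullet> ?N = 0"
    using unit[OF \<open>s \<in> I\<close>] cross(4)[OF \<open>s \<in> I\<close>]
      dot_cross_self[of ?T ?N] dot_cross_self[of ?N ?T]
    by (simp_all add: norm_eq_1 inner_commute cross_skew[of ?N] B[OF \<open>s \<in> I\<close>])
  have phi: "phi_s D T T v t = T t + (v * \<kappa> t) *\<^sub>R N t" if "t \<in> I" for t
    using DT[OF that] by (simp add: phi_s_def)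
  \<comment> \<open>The T part of \<open>phi_s\<close> is parallel to the ruling, so only (v
    \<kappa>) N x T = -(v \<kappa>) B remains, and normalizing leaves the sign.\<close>
  have U: "unit_normal D T T v t = - sgn (v * \<kappa> t) *\<^sub>R B t" if "t \<in> I" for t
  proof -
    have "cross3 (phi_s D T T v t) (phi_v T v t) = - (v * \<kappa> t) *\<^sub>R B t"
      using cross(1)[OF that]
      by (simp add: phi[OF that] phi_v_def cross_add_left cross_mult_left B[OF that])
    then show ?thesis
      using cross(4)[OF that]
      by (simp add: unit_normal_def real_sgn_eq divide_inverse abs_mult mult_ac)
  qed
  define \<sigma> where "\<sigma> = sgn (v * \<kappa> s)"
  have \<sigma>: "\<sigma> * \<sigma> = 1" "\<sigma> * (v * \<kappa> s) = \<bar>v * \<kappa> s\<bar>" "v * \<kappa> s \<noteq> 0"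
    using \<open>v \<noteq> 0\<close> \<kappa>[OF \<open>s \<in> I\<close>] by (auto simp: \<sigma>_def sgn_if abs_if)
  \<comment> \<open>Multiplying by \<sigma> makes the continuous function v \<kappa> positive at
    \<open>s\<close>, whatever its sign there; positivity persists nearby, and \<sigma> is 1 or
    -1.\<close>
  have "\<forall>\<^sub>F t in nhds s. sgn (v * \<kappa> t) = \<sigma>"
  proof -
    have "isCont (\<lambda>t. \<sigma> * (v * \<kappa> t)) s"
      using diff(4)[OF \<open>s \<in> I\<close>] by (intro continuous_intros differentiable_imp_continuous_within)
    then have "((\<lambda>t. \<sigma> * (v * \<kappa> t)) \<longlongrightarrow> \<sigma> * (v * \<kappa> s)) (nhds s)"
      using tendsto_at_iff_tendsto_nhds[of "\<lambda>t. \<sigma> * (v * \<kappa> t)" s] by (simp add: isCont_def)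
    then have "\<forall>\<^sub>F t in nhds s. \<sigma> * (v * \<kappa> t) > 0"
      by (rule order_tendstoD(1)) (use \<sigma>(2,3) in simp)
    then show ?thesis
      by eventually_elim (use \<sigma>(1) in \<open>auto simp: square_eq_1_iff sgn_if\<close>)
  qed
  moreover have "\<forall>\<^sub>F t in nhds s. t \<in> I"
    using \<open>open I\<close> \<open>s \<in> I\<close> by (rule eventually_nhds_in_open)
  ultimately have "\<forall>\<^sub>F t in nhds s. unit_normal D T T v t = - \<sigma> *\<^sub>R B t"
    by eventually_elim (simp add: U)
  then have "D (unit_normal D T T v) s = D (\<lambda>t. - \<sigma> *\<^sub>R B t) s"
    unfolding D_def by (rule cov_deriv_cong)
  also have "\<dots> = - \<sigma> *\<^sub>R D B s"
    using cov_deriv_scaleR[of m nabla E T s \<alpha> "\<lambda>_. - \<sigma>" B] linear diff(3)[OF \<open>s \<in> I\<close>]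
    by (simp add: D_def)
  finally have DU: "D (unit_normal D T T v) s = (\<sigma> * ?\<mu>) *\<^sub>R ?N"
    using DB[OF \<open>s \<in> I\<close>] by (simp add: algebra_simps)
  have "phi_ss D T T v s = D (\<lambda>t. T t + (v * \<kappa> t) *\<^sub>R N t) s"
    unfolding phi_ss_def using eventually_nhds_in_open[OF \<open>open I\<close> \<open>s \<in> I\<close>] phi
    unfolding D_def by (intro cov_deriv_cong) (auto elim: eventually_mono)
  also have "\<dots> = D T s + D (\<lambda>t. (v * \<kappa> t) *\<^sub>R N t) s"
    unfolding D_def using diff[OF \<open>s \<in> I\<close>]
    by (intro cov_deriv_add linear) auto
  \<comment> \<open>The derivative of v \<kappa> is left unevaluated: it multiplies N and drops out
    of the product with B.\<close>
  also have "D (\<lambda>t. (v * \<kappa> t) *\<^sub>R N t) s =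
      vector_derivative (\<lambda>t. v * \<kappa> t) (at s) *\<^sub>R ?N + (v * \<kappa> s) *\<^sub>R D N s"
    unfolding D_def using diff[OF \<open>s \<in> I\<close>]
    by (intro cov_deriv_scaleR linear) auto
  finally have e: "phi_ss D T T v s \<bullet> ?B = v * \<kappa> s * ?\<mu>"
    using dot by (simp add: DT DN \<open>s \<in> I\<close> inner_add_left inner_diff_left)
  have Us: "unit_normal D T T v s = - \<sigma> *\<^sub>R ?B"
    using U[OF \<open>s \<in> I\<close>] by (simp add: \<sigma>_def)
  have forms: "phi_s D T T v s \<bullet> phi_s D T T v s = 1 + (v * \<kappa> s)\<^sup>2"
    "phi_s D T T v s \<bullet> phi_v T v s = 1" "phi_v T v s \<bullet> phi_v T v s = 1"
    "phi_ss D T T v s \<bullet> unit_normal D T T v s = - \<bar>v * \<kappa> s\<bar> * ?\<mu>"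
    "phi_sv D T v s \<bullet> unit_normal D T T v s = 0" "phi_vv v s \<bullet> unit_normal D T T v s = 0"
    using dot e
    by (simp_all add: phi phi_v_def phi_sv_def phi_vv_def DT Us \<open>s \<in> I\<close> power2_eq_square
        inner_add_left inner_add_right flip: \<sigma>(2))
  \<comment> \<open>The ruling is T itself, so the determinant is the triple product of T, T and the
    derivative of T.\<close>
  have "distribution_parameter D T T s = 0"
    by (simp add: distribution_parameter_def flip: dot_cross_det) (simp add: dot_cross_self)
  \<comment> \<open>The mixed derivative is a multiple of N, orthogonal to the normal, and
    \<open>phi_vv\<close> is 0; both terms of the numerator vanish.\<close>
  moreover have "gauss_curvature D T T s v = 0"
    by (simp add: gauss_curvature_def forms)
  moreover have "mean_curvature D T T s v = - ?\<mu> / (2 * \<bar>v * \<kappa> s\<bar>)"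
  proof -
    \<comment> \<open>Treating the absolute value as one nonzero quantity lets a factor cancel from
      c / c^2 without a case split on signs.\<close>
    define c where "c = \<bar>v * \<kappa> s\<bar>"
    have "mean_curvature D T T s v = - (c * ?\<mu>) / (2 * (v * \<kappa> s)\<^sup>2)"
      unfolding mean_curvature_def Let_def forms c_def by simp
    also have "(v * \<kappa> s)\<^sup>2 = c * c"
      unfolding c_def by (simp only: power2_eq_square abs_mult_self_eq)
    finally show ?thesis
      using \<sigma>(3) unfolding c_def[symmetric] by (simp add: divide_simps)
  qed
  moreover have "geodesic_curvature D T T s v = - \<sigma> * \<kappa> s"
    using dot cross(2)[OF \<open>s \<in> I\<close>]
    by (simp add: geodesic_curvature_def Us DT \<open>s \<in> I\<close> cross_mult_left)
  moreover have "normal_curvature D T T s v = 0"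
    using dot by (simp add: normal_curvature_def Us DT \<open>s \<in> I\<close>)
  \<comment> \<open>The normal enters twice, so its sign squares away: its cross product with its
    derivative is (\<tau> + \<open>\<tau>\<^sub>G\<close>) T, which is orthogonal to \<kappa>
    N.\<close>
  moreover have "geodesic_torsion D T T s v = 0"
    using dot cross(3)[OF \<open>s \<in> I\<close>]
    by (simp add: geodesic_torsion_def Us DU DT \<open>s \<in> I\<close> cross_mult_left cross_mult_right)
  ultimately show ?thesis
    by (auto simp: Us \<sigma>_def mult.assoc add_divide_distrib diff_divide_distrib)
qed

end
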